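(* Let $K\ge 1$, let $V=(V_1,\dots,V_K)$ be the discrete vector of factors of a Bayesian hierarchical model, taking values in the model list $\mathcal{V}^K=\{v_{11},\dots,v_{1m_1}\}\times\cdots\times\{v_{K1},\dots,v_{Km_K}\}$, let $\mathcal{D}_n$ be the observed data, and let $Y_{n+1}$ be the real-valued future observation, with joint posterior law of $(V,Y_{n+1})$ given $\mathcal{D}_n$ as described in the context. Write $\mathrm{Var}(Y_{n+1}\mid\mathcal{D}_n)(\mathcal{V}^K)$ for the posterior predictive variance $\mathrm{Var}(Y_{n+1}\mid\mathcal{D}_n)$ in this model. Then the following hold. Clause (i). If $K=1$ (so $V=V_1$), then $$\mathrm{Var}(Y_{n+1}\mid\mathcal{D}_n)=E\big(\mathrm{Var}(Y_{n+1}\mid V,\mathcal{D}_n)\big)+\mathrm{Var}\big(E(Y_{n+1}\mid V,\mathcal{D}_n)\big),$$ where the outer expectation and variance are with respect to the posterior distribution of $V$ given $\mathcal{D}_n$. If $K\ge 2$, then $$\begin{aligned}\mathrm{Var}(Y_{n+1}\mid\mathcal{D}_n)(\mathcal{V}^K)={}&E_{(V_1,\dots,V_K)}\mathrm{Var}(Y_{n+1}\mid\mathcal{D}_n,V_1,\dots,V_K)\\&+\sum_{k=2}^{K}E_{(V_1,\dots,V_{k-1})}\mathrm{Var}_{V_k}E(Y_{n+1}\mid\mathcal{D}_n,V_1,\dots,V_k)\\&+\mathrm{Var}_{V_1}E(Y_{n+1}\mid\mathcal{D}_n,V_1).\end{aligned}$$ Clause (ii). For any $K\ge 1$, $$\m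athrm{Var}(Y_{n+1}\mid\mathcal{D}_n)(\mathcal{V}^K)=E_{(V_1,\dots,V_K)}\mathrm{Var}(Y_{n+1}\mid\mathcal{D}_n,V_1,\dots,V_K)+\mathrm{Var}_{(V_1,\dots,V_K)}E(Y_{n+1}\mid\mathcal{D}_n,V_1,\dots,V_K).$$
   Context: Hierarchical model: $V_1\sim w(v_1)$, $V_2\sim w(v_2\mid v_1)$, ..., $V_K\sim w(v_K\mid v_1,\dots,v_{K-1})$, and $Y\sim p(y\mid v)$ given $V=v=(v_1,\dots,v_K)$, where the $w$'s are prior densities and $p(\cdot\mid v)$ is the likelihood; all random variables are defined on one probability space. Each factor $V_k$ is discrete, with finitely many possible values (levels) $v_{k1},\dots,v_{km_k}$. The vector $V$ has prior probability mass function $W(v)=W(V_1=v_1,\dots,V_K=v_K)$, and the $V_k$ need not be independent. Any continuous parameters of the models have been integrated out, so that each $v\in\mathcal{V}^K$ indexes a model. $\mathcal{D}_n$ denotes the data from the first $n$ time steps (the outcomes $y_1,\dots,y_n$ of $Y$, possibly together with values of explanatory variables), and $Y_{n+1}$ is the next, real-valued, outcome. The value of $\mathcal{D}_n$ is fixed, and everything is conditional on it. The posterior of $V$ is $W(v\mid\mathcal{D}_n)$, the predictive density within model $v$ is $p(y_{n+1}\mid\mathcal{D}_n,v)$, and the posterior predictive density is $p(y_{n+1}\mid\mathcal{D}_n)=\sum_v p(y_{n+1}\mid\mathcal{D}_n,v)W(v\mid\mathcal{D}_n)$, where densities are with respect to Lebesgue measure for continuous variables and counting measure for discrete ones. $\mathrm{Var}(Y_{n+1}\mid\mathcal{D}_n)$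 is the variance under the posterior predictive density and is assumed to exist and be finite. Notation: $E(Y_{n+1}\mid\mathcal{D}_n,V_1,\dots,V_k)$ and $\mathrm{Var}(Y_{n+1}\mid\mathcal{D}_n,V_1,\dots,V_k)$ are the conditional mean and variance of $Y_{n+1}$ given $\mathcal{D}_n$ and $V_1,\dots,V_k$, with the remaining factors $V_{k+1},\dots,V_K$ integrated out under their conditional distribution given $\mathcal{D}_n,V_1,\dots,V_k$. $E_{(V_1,\dots,V_k)}$ and $\mathrm{Var}_{(V_1,\dots,V_k)}$ denote expectation and variance with respect to the posterior distribution of $(V_1,\dots,V_k)$ given $\mathcal{D}_n$; in particular $\mathrm{Var}_{V_1}$ is with respect to the posterior of $V_1$ given $\mathcal{D}_n$. For $k\ge 2$, $\mathrm{Var}_{V_k}$ in the sum denotes variance with respect to the conditional distribution of $V_k$ given $\mathcal{D}_n$ and $V_1,\dots,V_{k-1}$, so that it is a function of $(V_1,\dots,V_{k-1})$. *)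

theory Defs
  imports "HOL-Probability.Probability"
begin

text \<open>
  A tuple \<open>(v\<^sub>1, \<dots>, v\<^sub>k)\<close> of factor values is the list \<open>[v\<^sub>1, \<dots>, v\<^sub>k]\<close>; hence \<open>v\<^sub>k\<close> is
  \<open>v ! (k - 1)\<close> and the sub-vector \<open>(V\<^sub>1, \<dots>, V\<^sub>k)\<close> of \<open>V\<close> is \<open>take k V\<close>.

  Fields: \<open>prior_factor H [v\<^sub>1, \<dots>, v\<^sub>k\<^sub>-\<^sub>1]\<close> is \<open>w(\<cdot> | v\<^sub>1, \<dots>, v\<^sub>k\<^sub>-\<^sub>1)\<close>; \<open>likelihood H d v\<close> is
  \<open>p(d | v)\<close> for data \<open>d\<close>, and \<open>predictive H d v y\<close> is the density \<open>p(y\<^sub>n\<^sub>+\<^sub>1 = y | d, v)\<close> with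
  respect to \<open>base H\<close>, both with the continuous parameters of model \<open>v\<close> integrated out.
  Explanatory variables, if any, are part of \<open>d\<close>.
\<close>

record ('v, 'd) hmodel =
  n_factors :: nat
  levels :: "nat \<Rightarrow> 'v set"
  prior_factor :: "'v list \<Rightarrow> 'v pmf"
  likelihood :: "'d \<Rightarrow> 'v list \<Rightarrow> real"
  predictive :: "'d \<Rightarrow> 'v list \<Rightarrow> real \<Rightarrow> real"
  base :: "real measure"

definition model_list_upto :: "('v, 'd) hmodel \<Rightarrow> nat \<Rightarrow> 'v list set" where
  "model_list_upto H k = listset (map (levels H) [1..<Suc k])"

abbreviation model_list :: "('v, 'd) hmodel \<Rightarrow> 'v list set" where
  "model_list H \<equiv> model_list_upto H (n_factors H)"

primrec prior_upto :: "('v, 'd) hmodel \<Rightarrow> nat \<Rightarrow> 'v list pmf" where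
  "prior_upto H 0 = return_pmf []"
| "prior_upto H (Suc k) =
     bind_pmf (prior_upto H k) (\<lambda>u. map_pmf (\<lambda>x. u @ [x]) (prior_factor H u))"

abbreviation prior :: "('v, 'd) hmodel \<Rightarrow> 'v list pmf" where
  "prior H \<equiv> prior_upto H (n_factors H)"

definition evidence :: "('v, 'd) hmodel \<Rightarrow> 'd \<Rightarrow> real" where
  "evidence H d = (\<Sum>v\<in>model_list H. likelihood H d v * pmf (prior H) v)"

text \<open>
  The observed data must have positive marginal density for the posterior to exist.
  A predictive density is required only for models under which \<open>d\<close> has positive density, since
  \<open>p(y | d, v)\<close> is not defined for the others; those have posterior probability 0.
\<close>

definition hierarchical_model :: "('v, 'd) hmodel \<Rightarrow> 'd \<Rightarrow> bool" where
  "hierarchical_model H d \<longleftrightarrow>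
     1 \<le> n_factors H \<and>
     (\<forall>k\<in>{1..n_factors H}. finite (levels H k)) \<and>
     (\<forall>k<n_factors H. \<forall>u\<in>model_list_upto H k. set_pmf (prior_factor H u) \<subseteq> levels H (Suc k)) \<and>
     (\<forall>v\<in>model_list H. 0 \<le> likelihood H d v) \<and>
     0 < evidence H d \<and>
     (base H = lborel \<or> (\<exists>S. countable S \<and> base H = count_space S)) \<and>
     (\<forall>v\<in>model_list H. 0 < likelihood H d v \<longrightarrow>
        predictive H d v \<in> borel_measurable (base H) \<and>
        (\<forall>y\<in>space (base H). 0 \<le> predictive H d v y) \<and>
        (\<integral>\<^sup>+ y. ennreal (predictive H d v y) \<partial>base H) = 1)"

text \<open>Bayes' theorem: \<open>W(v | d)\<close>.\<close>

definition posterior :: "('v, 'd) hmodel \<Rightarrow> 'd \<Rightarrow> 'v list pmf" where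
  "posterior H d =
     embed_pmf (\<lambda>v. if v \<in> model_list H
                    then likelihood H d v * pmf (prior H) v / evidence H d else 0)"

definition posterior_upto :: "('v, 'd) hmodel \<Rightarrow> 'd \<Rightarrow> nat \<Rightarrow> 'v list pmf" where
  "posterior_upto H d k = map_pmf (take k) (posterior H d)"

text \<open>
  Conditional distributions given \<open>d\<close> and \<open>(V\<^sub>1, \<dots>, V\<^sub>k) = u\<close>, where \<open>k = length u\<close>: of the whole
  vector \<open>V\<close>, and of the next factor \<open>V\<^sub>k\<^sub>+\<^sub>1\<close>. They are meaningful only if \<open>u\<close> has positive
  posterior probability; other \<open>u\<close> have weight 0 in every expectation below.
\<close>

definition posterior_given :: "('v, 'd) hmodel \<Rightarrow> 'd \<Rightarrow> 'v list \<Rightarrow> 'v list pmf" where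
  "posterior_given H d u = cond_pmf (posterior H d) {v. take (length u) v = u}"

definition next_factor_given :: "('v, 'd) hmodel \<Rightarrow> 'd \<Rightarrow> 'v list \<Rightarrow> 'v pmf" where
  "next_factor_given H d u = map_pmf (\<lambda>v. v ! length u) (posterior_given H d u)"

definition posterior_predictive :: "('v, 'd) hmodel \<Rightarrow> 'd \<Rightarrow> real measure" where
  "posterior_predictive H d =
     density (base H)
       (\<lambda>y. ennreal (\<Sum>v\<in>model_list H. predictive H d v y * pmf (posterior H d) v))"

definition predictive_given :: "('v, 'd) hmodel \<Rightarrow> 'd \<Rightarrow> 'v list \<Rightarrow> real measure" where
  "predictive_given H d u =
     density (base H)
       (\<lambda>y. ennreal (\<Sum>v\<in>model_list H. predictive H d v y * pmf (posterior_given H d u) v))"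

definition Var_Y :: "('v, 'd) hmodel \<Rightarrow> 'd \<Rightarrow> real" where
  "Var_Y H d = prob_space.variance (posterior_predictive H d) (\<lambda>y. y)"

text \<open>\<open>E(Y\<^sub>n\<^sub>+\<^sub>1 | d, (V\<^sub>1, \<dots>, V\<^sub>k) = u)\<close> and \<open>Var(Y\<^sub>n\<^sub>+\<^sub>1 | d, (V\<^sub>1, \<dots>, V\<^sub>k) = u)\<close>, \<open>k = length u\<close>.\<close>

definition E_Y_given :: "('v, 'd) hmodel \<Rightarrow> 'd \<Rightarrow> 'v list \<Rightarrow> real" where
  "E_Y_given H d u = prob_space.expectation (predictive_given H d u) (\<lambda>y. y)"

definition Var_Y_given :: "('v, 'd) hmodel \<Rightarrow> 'd \<Rightarrow> 'v list \<Rightarrow> real" where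
  "Var_Y_given H d u = prob_space.variance (predictive_given H d u) (\<lambda>y. y)"

text \<open>The prior and the posterior have the expected mass functions.\<close>

lemma model_list_upto_Suc:
  "model_list_upto H (Suc k) = {u @ [x] | u x. u \<in> model_list_upto H k \<and> x \<in> levels H (Suc k)}"
proof -
  have "listset (As @ [B]) = {u @ [x] | u x. u \<in> listset As \<and> x \<in> B}" for As and B :: "'a set"
  proof (induction As)
    case Nil
    then show ?case by (auto simp: set_Cons_def)
  next
    case (Cons A As)
    have "listset ((A # As) @ [B]) = {a # u @ [x] | a u x. a \<in> A \<and> u \<in> listset As \<and> x \<in> B}"
      by (simp only: append_Cons listset.simps Cons.IH set_Cons_def) blast
    also have "\<dots> = {u @ [x] | u x. u \<in> listset (A # As) \<and> x \<in> B}"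
      by (simp only: listset.simps set_Cons_def mem_Collect_eq) (metis (no_types, lifting) append_Cons)
    finally show ?case .
  qed
  then show ?thesis by (simp add: model_list_upto_def)
qed

lemma finite_model_list:
  assumes "hierarchical_model H d" "k \<le> n_factors H"
  shows "finite (model_list_upto H k)"
  using assms(2)
proof (induction k)
  case 0 then show ?case by (simp add: model_list_upto_def)
next
  case (Suc k)
  have "finite (levels H (Suc k))" using assms(1) Suc.prems by (auto simp: hierarchical_model_def)
  moreover have "model_list_upto H (Suc k) = (\<lambda>(u,x). u @ [x]) ` (model_list_upto H k \<times> levels H (Suc k))"
    by (auto simp: model_list_upto_Suc)
  ultimately show ?case using Suc by simp
qed

lemma pmf_posterior:
  assumes "hierarchical_model H d"
  shows "pmf (posterior H d) v =
    (if v \<in> model_list H then likelihood H d v * pmf (prior H) v / evidence H d else 0)"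
proof -
  let ?f = "\<lambda>v. if v \<in> model_list H then likelihood H d v * pmf (prior H) v / evidence H d else 0"
  have fin: "finite (model_list H)" using finite_model_list[OF assms] by simp
  have ev: "0 < evidence H d" using assms by (simp add: hierarchical_model_def)
  have nn: "0 \<le> ?f v" for v using assms ev by (auto simp: hierarchical_model_def)
  have "(\<integral>\<^sup>+ v. ennreal (?f v) \<partial>count_space UNIV) = (\<Sum>v\<in>model_list H. ennreal (?f v))"
    by (rule nn_integral_count_space'[OF fin]) auto
  also have "\<dots> = ennreal (\<Sum>v\<in>model_list H. ?f v)"
    by (rule sum_ennreal) (use nn in blast)
  also have "(\<Sum>v\<in>model_list H. ?f v) = 1"
    using ev by (simp add: evidence_def flip: sum_divide_distrib)
  finally show ?thesis
    unfolding posterior_def using pmf_embed_pmf[of ?f, OF nn] by simp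
qed

lemma pmf_prior_snoc:
  "pmf (prior_upto H (Suc k)) (u @ [x]) = pmf (prior_upto H k) u * pmf (prior_factor H u) x"
proof -
  have "pmf (map_pmf (\<lambda>x. u' @ [x]) (prior_factor H u')) (u @ [x]) = indicator {u} u' * pmf (prior_factor H u) x" for u'
  proof (cases "u' = u")
    case True
    then show ?thesis using pmf_map_inj'[of "\<lambda>x. u @ [x]" "prior_factor H u" x] by (simp add: inj_on_def)
  next
    case False
    then show ?thesis by (auto simp: pmf_eq_0_set_pmf)
  qed
  then show ?thesis by (simp add: pmf_bind measure_pmf_single)
qed

lemma set_prior:
  "hierarchical_model H d \<Longrightarrow> k \<le> n_factors H \<Longrightarrow> set_pmf (prior_upto H k) \<subseteq> model_list_upto H k"
proof (induction k)
  case 0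
  then show ?case by (simp add: model_list_upto_def)
next
  case (Suc k)
  have sub: "set_pmf (prior_upto H k) \<subseteq> model_list_upto H k" using Suc by simp
  have "set_pmf (prior_factor H u) \<subseteq> levels H (Suc k)" if "u \<in> set_pmf (prior_upto H k)" for u
    using Suc.prems sub that unfolding hierarchical_model_def by (meson Suc_le_eq subsetD)
  with sub show ?case
    unfolding model_list_upto_Suc prior_upto.simps set_bind_pmf set_map_pmf by blast
qed

end

theory Submission imports Defs begin

text \<open>
  For a posterior law \<open>Q\<close> of the factors, the predictive measure is a finite mixture, so its first two
  moments are the \<open>Q\<close>-means of the moments \<open>a(v)\<close>, \<open>b(v)\<close> within the models, and its variance is
  \<open>E\<^sub>Q b - (E\<^sub>Q a)\<^sup>2\<close>. Put \<open>e\<^sub>k = E (E(Y | V\<^sub>1, \<dots>, V\<^sub>k)\<^sup>2)\<close>. By the tower property the expected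
  within-variance at level \<open>k\<close> is \<open>E b - e\<^sub>k\<close>, the variance of the conditional mean at level \<open>k\<close> is
  \<open>e\<^sub>k - (E a)\<^sup>2\<close>, and the \<open>k\<close>-th term of the sum is \<open>e\<^sub>k - e\<^sub>k\<^sub>-\<^sub>1\<close>, so that everything telescopes.
\<close>

section \<open>Probability mass functions of finite support\<close>

lemma variance_pmf_finite:
  fixes f :: "'a \<Rightarrow> real"
  assumes "finite (set_pmf P)"
  shows "measure_pmf.variance P f =
    measure_pmf.expectation P (\<lambda>x. (f x)\<^sup>2) - (measure_pmf.expectation P f)\<^sup>2"
  by (rule measure_pmf.variance_eq) (simp_all add: integrable_measure_pmf_finite assms)

lemma expectation_pmf_cong:
  fixes f g :: "'a \<Rightarrow> real"
  assumes "\<And>x. x \<in> set_pmf P \<Longrightarrow> f x = g x"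
  shows "measure_pmf.expectation P f = measure_pmf.expectation P g"
  by (rule integral_cong_AE) (use assms in \<open>auto simp: AE_measure_pmf_iff\<close>)

text \<open>Disintegration along \<open>t\<close>: \<open>bind_cond_pmf_cancel\<close> applies to
  the relation \<open>t v = u\<close>, because the fibre over \<open>u\<close> has the same mass
  under \<open>P\<close> as the point \<open>u\<close> has under the image law.\<close>

lemma bind_cond_pmf_fibre:
  "bind_pmf (map_pmf t P) (\<lambda>u. cond_pmf P {v. t v = u}) = P"
proof (rule bind_cond_pmf_cancel)
  fix u v
  assume "t v = u"
  have "measure P {v. t v = u} = measure P (t -` {u})"
    by (rule arg_cong[of _ _ "measure P"]) auto
  also have "\<dots> = measure (map_pmf t P) {u}"
    by simp
  also have "{u} = {u'. t v = u'}"
    using \<open>t v = u\<close> by auto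
  finally show "measure P {v. t v = u} = measure (map_pmf t P) {u'. t v = u'}" .
qed auto

text \<open>Tower property, read off from the disintegration; finite supports turn the expectation
  over the \<open>bind_pmf\<close> into a finite weighted sum.\<close>

lemma expectation_cond_pmf_fibre:
  fixes h :: "'a \<Rightarrow> real"
  assumes "finite (set_pmf P)"
  shows "measure_pmf.expectation (map_pmf t P)
      (\<lambda>u. measure_pmf.expectation (cond_pmf P {v. t v = u}) h) = measure_pmf.expectation P h"
proof -
  let ?S = "set_pmf (map_pmf t P)"
  have fin: "finite ?S"
    using assms by simp
  \<comment> \<open>A value \<open>u\<close> in the support of the image has a fibre that meets the
    support of \<open>P\<close>, so \<open>cond_pmf\<close> is a genuine conditional law
    there.\<close>
  have "finite (set_pmf (cond_pmf P {v. t v = u}))" if "u \<in> ?S" for u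
  proof -
    have "set_pmf P \<inter> {v. t v = u} \<noteq> {}"
      using that by auto
    then show ?thesis
      using assms by simp
  qed
  then have "measure_pmf.expectation (bind_pmf (map_pmf t P) (\<lambda>u. cond_pmf P {v. t v = u})) h
      = (\<Sum>u\<in>?S. pmf (map_pmf t P) u *\<^sub>R measure_pmf.expectation (cond_pmf P {v. t v = u}) h)"
    using fin by (intro pmf_expectation_bind) auto
  also have "\<dots> = measure_pmf.expectation (map_pmf t P)
      (\<lambda>u. measure_pmf.expectation (cond_pmf P {v. t v = u}) h)"
    using fin by (intro integral_measure_pmf[symmetric]) auto
  finally show ?thesis
    by (simp add: bind_cond_pmf_fibre)
qed

text \<open>The normalising constant of the first conditioning cancels, since \<open>B\<close> lies
  inside \<open>A\<close>. This lets successive conditioning on longer and longer prefixes collapse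
  to a single conditioning.\<close>

lemma cond_cond_pmf:
  assumes "B \<subseteq> A" "set_pmf P \<inter> B \<noteq> {}"
  shows "cond_pmf (cond_pmf P A) B = cond_pmf P B"
proof (rule pmf_eqI)
  fix x
  have A: "set_pmf P \<inter> A \<noteq> {}"
    using assms by auto
  have B: "set_pmf (cond_pmf P A) \<inter> B \<noteq> {}"
    using assms by (auto simp: set_cond_pmf[OF A])
  have "measure (cond_pmf P A) B = measure P B / measure P A"
  proof -
    have "measure (cond_pmf P A) B = measure (uniform_measure (measure_pmf P) A) B"
      using measure_measure_pmf_not_zero[OF A]
      by (simp add: cond_pmf.rep_eq[OF A])
    also have "\<dots> = measure P (A \<inter> B) / measure P A"
      by (rule measure_uniform_measure)
        (use emeasure_measure_pmf_not_zero[OF A] in \<open>auto simp: measure_pmf.emeasure_eq_measure\<close>)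
    finally show ?thesis
      using assms(1) by (simp add: Int_absorb1)
  qed
  then show "pmf (cond_pmf (cond_pmf P A) B) x = pmf (cond_pmf P B) x"
    using assms measure_measure_pmf_not_zero[OF A]
    by (auto simp: pmf_cond[OF A] pmf_cond[OF B] pmf_cond[OF assms(2)])
qed

section \<open>Finite mixtures of densities\<close>

text \<open>The components are constrained only on the support of \<open>Q\<close>, as a model of
  likelihood zero may have an arbitrary predictive function; the sum over \<open>A\<close> gives
  such components weight zero.\<close>

locale finite_mixture =
  fixes M :: "'a measure" and A :: "'b set" and Q :: "'b pmf" and f :: "'b \<Rightarrow> 'a \<Rightarrow> real"
  assumes finite_A: "finite A"
    and support: "set_pmf Q \<subseteq> A"
    and meas: "\<And>v. v \<in> set_pmf Q \<Longrightarrow> f v \<in> borel_measurable M"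
    and nonneg: "\<And>v y. v \<in> set_pmf Q \<Longrightarrow> y \<in> space M \<Longrightarrow> 0 \<le> f v y"
begin

definition mixture :: "'a measure" where
  "mixture = density M (\<lambda>y. ennreal (\<Sum>v\<in>A. f v y * pmf Q v))"

lemma sum_support: "(\<Sum>v\<in>A. f v y * pmf Q v) = (\<Sum>v\<in>set_pmf Q. f v y * pmf Q v)"
  using finite_A support by (intro sum.mono_neutral_right) (auto simp: set_pmf_iff)

lemma mixture_meas: "(\<lambda>y. \<Sum>v\<in>A. f v y * pmf Q v) \<in> borel_measurable M"
  unfolding sum_support using meas by auto

lemma mixture_nonneg: "y \<in> space M \<Longrightarrow> 0 \<le> (\<Sum>v\<in>A. f v y * pmf Q v)"
  unfolding sum_support by (intro sum_nonneg) (simp add: nonneg)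

lemma has_integral_mixture:
  fixes g :: "'a \<Rightarrow> real"
  assumes g: "g \<in> borel_measurable M"
    and int: "\<And>v. v \<in> set_pmf Q \<Longrightarrow> integrable M (\<lambda>y. f v y * g y)"
  shows "integrable mixture g"
    and "integral\<^sup>L mixture g = measure_pmf.expectation Q (\<lambda>v. \<integral>y. f v y * g y \<partial>M)"
proof -
  have eq: "(\<Sum>v\<in>A. f v y * pmf Q v) *\<^sub>R g y = (\<Sum>v\<in>set_pmf Q. pmf Q v * (f v y * g y))" for y
    unfolding sum_support by (simp add: sum_distrib_left mult_ac)
  have nn: "AE y in M. 0 \<le> (\<Sum>v\<in>A. f v y * pmf Q v)"
    by (rule AE_I2) (rule mixture_nonneg)
  show "integrable mixture g"
    unfolding mixture_def integrable_density[OF g mixture_meas nn] eq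
    using int by (intro Bochner_Integration.integrable_sum integrable_mult_right) auto
  have "integral\<^sup>L mixture g = (\<integral>y. (\<Sum>v\<in>set_pmf Q. pmf Q v * (f v y * g y)) \<partial>M)"
    unfolding mixture_def integral_density[OF g mixture_meas nn] eq ..
  also have "\<dots> = (\<Sum>v\<in>set_pmf Q. \<integral>y. pmf Q v * (f v y * g y) \<partial>M)"
    using int by (intro Bochner_Integration.integral_sum integrable_mult_right) auto
  also have "\<dots> = measure_pmf.expectation Q (\<lambda>v. \<integral>y. f v y * g y \<partial>M)"
    using finite_subset[OF support finite_A] by (simp add: integral_measure_pmf[of "set_pmf Q"])
  finally show "integral\<^sup>L mixture g = measure_pmf.expectation Q (\<lambda>v. \<integral>y. f v y * g y \<partial>M)" .
qed

text \<open>Passes integrability from the mixture down to its components: a weighted component is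
  dominated by the whole nonnegative sum, and its weight is nonzero on the support of
  \<open>Q\<close>, so it can be divided out.\<close>

lemma integrable_component:
  fixes g :: "'a \<Rightarrow> real"
  assumes g: "g \<in> borel_measurable M" "\<And>y. y \<in> space M \<Longrightarrow> 0 \<le> g y"
    and int: "integrable mixture g" and v: "v \<in> set_pmf Q"
  shows "integrable M (\<lambda>y. f v y * g y)"
proof -
  let ?s = "\<lambda>y. \<Sum>v\<in>A. f v y * pmf Q v"
  have nn: "AE y in M. 0 \<le> ?s y"
    by (rule AE_I2) (rule mixture_nonneg)
  have s: "integrable M (\<lambda>y. ?s y *\<^sub>R g y)"
    using int unfolding mixture_def integrable_density[OF g(1) mixture_meas nn] .
  have "integrable M (\<lambda>y. pmf Q v * (f v y * g y))"
  proof (rule Bochner_Integration.integrable_bound[OF s])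
    show "(\<lambda>y. pmf Q v * (f v y * g y)) \<in> borel_measurable M"
      using meas[OF v] g(1) by simp
    show "AE y in M. norm (pmf Q v * (f v y * g y)) \<le> norm (?s y *\<^sub>R g y)"
    proof (rule AE_I2)
      fix y assume y: "y \<in> space M"
      have "f v y * pmf Q v \<le> ?s y"
        unfolding sum_support using v y finite_subset[OF support finite_A]
        by (intro member_le_sum) (auto simp: nonneg)
      then have "f v y * pmf Q v * g y \<le> ?s y * g y"
        by (rule mult_right_mono) (simp add: g y)
      moreover have "0 \<le> f v y * pmf Q v * g y"
        by (simp add: nonneg[OF v y] g(2)[OF y])
      ultimately show "norm (pmf Q v * (f v y * g y)) \<le> norm (?s y *\<^sub>R g y)"
        by (simp add: mult_ac)
    qed
  qed
  then show ?thesis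
    using v by (simp add: set_pmf_iff)
qed

lemma prob_space_mixture:
  assumes "\<And>v. v \<in> set_pmf Q \<Longrightarrow> (\<integral>\<^sup>+ y. ennreal (f v y) \<partial>M) = 1"
  shows "prob_space mixture"
proof -
  have int: "integrable M (f v) \<and> integral\<^sup>L M (f v) = 1" if "v \<in> set_pmf Q" for v
    using nn_integral_eq_integrable[of "f v" M 1] meas[OF that] nonneg[OF that] assms[OF that]
    by (auto intro: AE_I2)
  have "measure mixture (space mixture) = integral\<^sup>L mixture (\<lambda>_. 1)"
    by simp
  also have "\<dots> = measure_pmf.expectation Q (\<lambda>v. \<integral>y. f v y * 1 \<partial>M)"
    using int by (intro has_integral_mixture) auto
  also have "\<dots> = measure_pmf.expectation Q (\<lambda>v. 1)"
    using int by (intro expectation_pmf_cong) simp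
  finally have "measure mixture (space mixture) = 1"
    by simp
  \<comment> \<open>\<open>measure\<close> returns 0 on infinite mass, so the real value 1 excludes
    that case for \<open>emeasure\<close>.\<close>
  then show ?thesis
    by (intro prob_spaceI) (metis emeasure_eq_ennreal_measure ennreal_1 measure_zero_top zero_neq_one)
qed

end

section \<open>Posterior and predictive distributions\<close>

text \<open>The cases \<open>n = 1\<close> and \<open>n = 2\<close> are the a(v) and b(v) of the
  overview.\<close>

definition predictive_moment :: "('v, 'd) hmodel \<Rightarrow> 'd \<Rightarrow> nat \<Rightarrow> 'v list \<Rightarrow> real" where
  "predictive_moment H d n v = (\<integral>y. predictive H d v y * y ^ n \<partial>base H)"

text \<open>Finite predictive variance is expressed as square integrability; the mean then exists as
  well, because the total mass is 1.\<close>

locale posterior_model =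
  fixes H :: "('v, 'd) hmodel" and d :: 'd
  assumes model: "hierarchical_model H d"
    and finite_variance: "integrable (posterior_predictive H d) (\<lambda>y. y\<^sup>2)"
begin

abbreviation "E_given u h \<equiv> measure_pmf.expectation (posterior_given H d u) h"
abbreviation "E_post h \<equiv> measure_pmf.expectation (posterior H d) h"
abbreviation "E_upto k h \<equiv> measure_pmf.expectation (posterior_upto H d k) h"

text \<open>By Bayes' formula, positive posterior mass forces positive likelihood, which is the
  condition under which \<open>hierarchical_model\<close> makes the predictive function a
  density.\<close>

lemma set_posterior:
  assumes "v \<in> set_pmf (posterior H d)"
  shows "v \<in> model_list H" "0 < likelihood H d v"
proof -
  have "pmf (posterior H d) v \<noteq> 0"
    using assms by (simp add: set_pmf_iff)
  then have v: "v \<in> model_list H \<and> likelihood H d v \<noteq> 0"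
    by (simp add: pmf_posterior[OF model] split: if_splits)
  have "\<forall>v\<in>model_list H. 0 \<le> likelihood H d v"
    using model unfolding hierarchical_model_def by (elim conjE)
  with v show "v \<in> model_list H" "0 < likelihood H d v"
    by (auto simp: less_le)
qed

lemma predictive_density:
  assumes "v \<in> set_pmf (posterior H d)"
  shows "predictive H d v \<in> borel_measurable (base H)"
    and "\<And>y. y \<in> space (base H) \<Longrightarrow> 0 \<le> predictive H d v y"
    and "(\<integral>\<^sup>+ y. ennreal (predictive H d v y) \<partial>base H) = 1"
proof -
  have "\<forall>v\<in>model_list H. 0 < likelihood H d v \<longrightarrow>
      predictive H d v \<in> borel_measurable (base H) \<and>
      (\<forall>y\<in>space (base H). 0 \<le> predictive H d v y) \<and>
      (\<integral>\<^sup>+ y. ennreal (predictive H d v y) \<partial>base H) = 1"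
    using model unfolding hierarchical_model_def by (elim conjE)
  then show "predictive H d v \<in> borel_measurable (base H)"
    and "\<And>y. y \<in> space (base H) \<Longrightarrow> 0 \<le> predictive H d v y"
    and "(\<integral>\<^sup>+ y. ennreal (predictive H d v y) \<partial>base H) = 1"
    using set_posterior[OF assms] by simp_all
qed

lemma finite_posterior: "finite (set_pmf (posterior H d))"
  using finite_subset[OF _ finite_model_list[OF model order.refl]] set_posterior(1) by blast

lemma length_model_list_upto: "v \<in> model_list_upto H k \<Longrightarrow> length v = k"
  by (induction k arbitrary: v) (auto simp: model_list_upto_Suc, simp add: model_list_upto_def)

lemma length_posterior: "v \<in> set_pmf (posterior H d) \<Longrightarrow> length v = n_factors H"
  using set_posterior(1) length_model_list_upto by blast

lemma finite_mixture_posterior: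
  assumes "set_pmf Q \<subseteq> set_pmf (posterior H d)"
  shows "finite_mixture (base H) (model_list H) Q (predictive H d)"
proof
  show "finite (model_list H)"
    by (rule finite_model_list[OF model order.refl])
  show "set_pmf Q \<subseteq> model_list H"
    using assms set_posterior by blast
qed (use assms predictive_density in blast)+

section \<open>Moments of the predictive densities\<close>

lemma borel_measurable_base:
  fixes g :: "real \<Rightarrow> real"
  assumes "g \<in> borel_measurable borel"
  shows "g \<in> borel_measurable (base H)"
proof -
  have "base H = lborel \<or> (\<exists>S. countable S \<and> base H = count_space S)"
    using model unfolding hierarchical_model_def by (elim conjE)
  then show ?thesis
    using assms by auto
qed

lemma integrable_moment:
  assumes v: "v \<in> set_pmf (posterior H d)" and n: "n \<le> 2"
  shows "integrable (base H) (\<lambda>y. predictive H d v y * y ^ n)"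
proof -
  interpret finite_mixture "base H" "model_list H" "posterior H d" "predictive H d"
    by (rule finite_mixture_posterior) simp
  have sq: "integrable (base H) (\<lambda>y. predictive H d v y * y\<^sup>2)"
    by (rule integrable_component[OF borel_measurable_base _ _ v])
      (use finite_variance in \<open>auto simp: mixture_def posterior_predictive_def\<close>)
  have one: "integrable (base H) (predictive H d v)"
    using nn_integral_eq_integrable[of "predictive H d v" "base H" 1] predictive_density[OF v]
    by (auto intro: AE_I2)
  \<comment> \<open>The moments of order at most 2 share the dominating function p(y) (1 +
    y^2).\<close>
  have "integrable (base H) (\<lambda>y. predictive H d v y + predictive H d v y * y\<^sup>2)"
    using one sq by (rule Bochner_Integration.integrable_add)
  then show ?thesis
  proof (rule Bochner_Integration.integrable_bound)
    show "(\<lambda>y. predictive H d v y * y ^ n) \<in> borel_measurable (base H)"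
      using meas[OF v] borel_measurable_base[of "\<lambda>y. y ^ n"] by simp
    show "AE y in base H. norm (predictive H d v y * y ^ n)
        \<le> norm (predictive H d v y + predictive H d v y * y\<^sup>2)"
    proof (rule AE_I2)
      fix y assume "y \<in> space (base H)"
      then have p: "0 \<le> predictive H d v y"
        by (rule nonneg[OF v])
      have "\<bar>y\<bar> ^ n \<le> 1 + y\<^sup>2"
      proof (cases "\<bar>y\<bar> \<le> 1")
        case True
        then have "\<bar>y\<bar> ^ n \<le> 1"
          by (simp add: power_le_one)
        then show ?thesis
          by (smt (verit) zero_le_power2)
      next
        case False
        then have "\<bar>y\<bar> ^ n \<le> \<bar>y\<bar> ^ 2"
          using n by (intro power_increasing) auto
        then show ?thesis
          by simp
      qed
      then have "predictive H d v y * \<bar>y\<bar> ^ n \<le> predictive H d v y * (1 + y\<^sup>2)"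
        using p by (rule mult_left_mono)
      then show "norm (predictive H d v y * y ^ n)
          \<le> norm (predictive H d v y + predictive H d v y * y\<^sup>2)"
        using p by (simp add: abs_mult power_abs distrib_left)
    qed
  qed
qed

text \<open>Stated for any law supported within the posterior, so that one computation serves both
  \<open>posterior_predictive\<close> and every \<open>predictive_given\<close>.\<close>

lemma mixture_moments:
  assumes Q: "set_pmf Q \<subseteq> set_pmf (posterior H d)"
  defines "D \<equiv> density (base H) (\<lambda>y. ennreal (\<Sum>v\<in>model_list H. predictive H d v y * pmf Q v))"
  shows "prob_space.expectation D (\<lambda>y. y) = measure_pmf.expectation Q (predictive_moment H d 1)"
    and "prob_space.variance D (\<lambda>y. y) = measure_pmf.expectation Q (predictive_moment H d 2)
      - (measure_pmf.expectation Q (predictive_moment H d 1))\<^sup>2"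
proof -
  interpret finite_mixture "base H" "model_list H" Q "predictive H d"
    by (rule finite_mixture_posterior[OF Q])
  have D: "D = mixture"
    by (simp add: D_def mixture_def)
  interpret prob_space D
    unfolding D by (rule prob_space_mixture)
      (use Q predictive_density in blast)
  have moment: "integrable D (\<lambda>y. y ^ n)"
      "expectation (\<lambda>y. y ^ n) = measure_pmf.expectation Q (predictive_moment H d n)" if "n \<le> 2" for n
    unfolding D predictive_moment_def
    by (rule has_integral_mixture borel_measurable_base integrable_moment that subsetD[OF Q]
        borel_measurable_power measurable_ident_sets refl | assumption)+
  show "expectation (\<lambda>y. y) = measure_pmf.expectation Q (predictive_moment H d 1)"
    using moment(2)[of 1] by simp
  show "variance (\<lambda>y. y) = measure_pmf.expectation Q (predictive_moment H d 2)
      - (measure_pmf.expectation Q (predictive_moment H d 1))\<^sup>2"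
    using moment[of 1] moment[of 2] by (subst variance_eq) simp_all
qed

lemma Var_Y_eq:
  "Var_Y H d = E_post (predictive_moment H d 2) - (E_post (predictive_moment H d 1))\<^sup>2"
  unfolding Var_Y_def posterior_predictive_def by (rule mixture_moments) simp

section \<open>Conditioning on the first factors\<close>

lemma finite_posterior_upto: "finite (set_pmf (posterior_upto H d k))"
  by (simp add: posterior_upto_def finite_posterior)

text \<open>Supplies what \<open>posterior_given\<close> needs: the length of \<open>u\<close>
  recovers the level \<open>k\<close>, and the conditioning event has positive mass.\<close>

lemma set_posterior_upto:
  assumes "k \<le> n_factors H" "u \<in> set_pmf (posterior_upto H d k)"
  shows "length u = k" "set_pmf (posterior H d) \<inter> {v. take (length u) v = u} \<noteq> {}"
proof -
  obtain v where "v \<in> set_pmf (posterior H d)" "u = take k v"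
    using assms(2) by (auto simp: posterior_upto_def)
  moreover from this show "length u = k"
    using assms(1) length_posterior by simp
  ultimately show "set_pmf (posterior H d) \<inter> {v. take (length u) v = u} \<noteq> {}"
    by auto
qed

lemma set_posterior_given:
  assumes "k \<le> n_factors H" "u \<in> set_pmf (posterior_upto H d k)"
  shows "set_pmf (posterior_given H d u) = {v \<in> set_pmf (posterior H d). take k v = u}"
  unfolding posterior_given_def set_cond_pmf[OF set_posterior_upto(2)[OF assms]]
  using set_posterior_upto(1)[OF assms] by auto

lemma given_moments:
  assumes "k \<le> n_factors H" "u \<in> set_pmf (posterior_upto H d k)"
  shows "E_Y_given H d u = E_given u (predictive_moment H d 1)"
    and "Var_Y_given H d u = E_given u (predictive_moment H d 2) - (E_Y_given H d u)\<^sup>2"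
proof -
  have Q: "set_pmf (posterior_given H d u) \<subseteq> set_pmf (posterior H d)"
    unfolding set_posterior_given[OF assms] by auto
  show E: "E_Y_given H d u = E_given u (predictive_moment H d 1)"
    unfolding E_Y_given_def predictive_given_def by (rule mixture_moments(1)[OF Q])
  show "Var_Y_given H d u = E_given u (predictive_moment H d 2) - (E_Y_given H d u)\<^sup>2"
    unfolding E unfolding Var_Y_given_def predictive_given_def by (rule mixture_moments(2)[OF Q])
qed

text \<open>The tower property for the fibres of \<open>take k\<close>.\<close>

lemma E_upto_E_given:
  fixes h :: "'v list \<Rightarrow> real"
  assumes "k \<le> n_factors H"
  shows "E_upto k (\<lambda>u. E_given u h) = E_post h"
proof -
  have "E_upto k (\<lambda>u. E_given u h) =
      E_upto k (\<lambda>u. measure_pmf.expectation (cond_pmf (posterior H d) {v. take k v = u}) h)"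
    by (rule expectation_pmf_cong) (simp add: posterior_given_def set_posterior_upto(1)[OF assms])
  also have "\<dots> = E_post h"
    unfolding posterior_upto_def by (rule expectation_cond_pmf_fibre[OF finite_posterior])
  finally show ?thesis .
qed

text \<open>Tower property relative to a fixed prefix \<open>u\<close>: the fibre lemma is applied
  to the conditional law given \<open>u\<close>, and conditioning that law on the first
  \<open>l\<close> factors agrees with conditioning the posterior on them directly.\<close>

lemma E_given_E_given:
  fixes h :: "'v list \<Rightarrow> real"
  assumes u: "u \<in> set_pmf (posterior_upto H d k)" and k: "k \<le> l" "l \<le> n_factors H"
  shows "E_given u (\<lambda>v. E_given (take l v) h) = E_given u h"
proof -
  let ?Q = "posterior_given H d u"
  have kn: "k \<le> n_factors H"
    using k by simp
  note Q = set_posterior_given[OF kn u]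
  have "finite (set_pmf ?Q)"
    unfolding Q using finite_posterior by simp
  then have "E_given u h = measure_pmf.expectation (map_pmf (take l) ?Q)
      (\<lambda>w. measure_pmf.expectation (cond_pmf ?Q {v. take l v = w}) h)"
    by (rule expectation_cond_pmf_fibre[symmetric])
  also have "\<dots> = E_given u (\<lambda>v. E_given (take l v) h)"
    unfolding integral_map_pmf
  proof (rule expectation_pmf_cong)
    fix v assume "v \<in> set_pmf ?Q"
    then have v: "v \<in> set_pmf (posterior H d)" "take k v = u"
      unfolding Q by auto
    have len: "length u = k" "length (take l v) = l"
      using set_posterior_upto(1)[OF kn u] length_posterior[OF v(1)] k by auto
    \<comment> \<open>The longer prefix determines the shorter one; this is the inclusion of events
      that \<open>cond_cond_pmf\<close> requires.\<close>
    have "take k v' = u" if "take l v' = take l v" for v'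
      using arg_cong[OF that, of "take k"] k v(2) by (simp add: min_absorb1)
    then have "cond_pmf ?Q {v'. take l v' = take l v} = posterior_given H d (take l v)"
      unfolding posterior_given_def len
      by (intro cond_cond_pmf) (use v in auto)
    then show "measure_pmf.expectation (cond_pmf ?Q {v'. take l v' = take l v}) h
        = E_given (take l v) h"
      by simp
  qed
  finally show ?thesis ..
qed

lemma take_in_posterior_upto:
  "v \<in> set_pmf (posterior H d) \<Longrightarrow> take k v \<in> set_pmf (posterior_upto H d k)"
  by (simp add: posterior_upto_def)

section \<open>Variance identities at a fixed level and their telescoping sum\<close>

lemma E_upto_Var_Y_given:
  assumes "k \<le> n_factors H"
  shows "E_upto k (Var_Y_given H d) =
    E_post (predictive_moment H d 2) - E_upto k (\<lambda>u. (E_Y_given H d u)\<^sup>2)"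
proof -
  have "E_upto k (Var_Y_given H d) =
      E_upto k (\<lambda>u. E_given u (predictive_moment H d 2) - (E_Y_given H d u)\<^sup>2)"
    by (rule expectation_pmf_cong) (rule given_moments(2)[OF assms])
  also have "\<dots> = E_upto k (\<lambda>u. E_given u (predictive_moment H d 2))
      - E_upto k (\<lambda>u. (E_Y_given H d u)\<^sup>2)"
    by (intro Bochner_Integration.integral_diff integrable_measure_pmf_finite finite_posterior_upto)
  finally show ?thesis
    by (simp add: E_upto_E_given[OF assms])
qed

lemma Var_upto_E_Y_given:
  assumes "k \<le> n_factors H"
  shows "measure_pmf.variance (posterior_upto H d k) (E_Y_given H d) =
    E_upto k (\<lambda>u. (E_Y_given H d u)\<^sup>2) - (E_post (predictive_moment H d 1))\<^sup>2"
proof -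
  have "E_upto k (E_Y_given H d) = E_upto k (\<lambda>u. E_given u (predictive_moment H d 1))"
    by (rule expectation_pmf_cong) (rule given_moments(1)[OF assms])
  then show ?thesis
    unfolding variance_pmf_finite[OF finite_posterior_upto] E_upto_E_given[OF assms] by simp
qed

text \<open>The two terms e_k cancel, at every level \<open>k\<close>; the full level
  \<open>n_factors H\<close> gives clause (ii).\<close>

lemma Var_Y_decomposition:
  assumes "k \<le> n_factors H"
  shows "Var_Y H d = E_upto k (Var_Y_given H d)
    + measure_pmf.variance (posterior_upto H d k) (E_Y_given H d)"
  by (simp add: Var_Y_eq E_upto_Var_Y_given Var_upto_E_Y_given assms)

text \<open>Replaces the law of the next factor by the conditional law of the whole vector, for
  which the tower properties are stated.\<close>

lemma expectation_next_factor:
  fixes g :: "'v list \<Rightarrow> real"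
  assumes "k < n_factors H" "u \<in> set_pmf (posterior_upto H d k)"
  shows "measure_pmf.expectation (next_factor_given H d u) (\<lambda>x. g (u @ [x])) =
    E_given u (\<lambda>v. g (take (Suc k) v))"
  unfolding next_factor_given_def integral_map_pmf
proof (rule expectation_pmf_cong)
  fix v assume "v \<in> set_pmf (posterior_given H d u)"
  then have "v \<in> set_pmf (posterior H d)" "take k v = u"
    using set_posterior_given[of k u] assms by auto
  \<comment> \<open>List indices start at 0, so position \<open>length u = k\<close> holds factor
    k+1; it exists because \<open>k < n_factors H\<close>.\<close>
  then have "u @ [v ! length u] = take (Suc k) v"
    using set_posterior_upto(1)[of k u] length_posterior[of v] assms
    by (simp add: take_Suc_conv_app_nth)
  then show "g (u @ [v ! length u]) = g (take (Suc k) v)"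
    by simp
qed

text \<open>Given \<open>u\<close>, the level k+1 means average to the level k mean, so the inner
  variance is their conditional second moment minus the square of that mean. Averaging over
  \<open>u\<close> yields e_{k+1} - e_k.\<close>

lemma E_upto_Var_next_factor:
  assumes k: "k < n_factors H"
  shows "E_upto k (\<lambda>u. measure_pmf.variance (next_factor_given H d u)
        (\<lambda>x. E_Y_given H d (u @ [x]))) =
    E_upto (Suc k) (\<lambda>u. (E_Y_given H d u)\<^sup>2) - E_upto k (\<lambda>u. (E_Y_given H d u)\<^sup>2)"
proof -
  let ?sq = "\<lambda>v. (E_Y_given H d (take (Suc k) v))\<^sup>2"
  have "E_upto k (\<lambda>u. measure_pmf.variance (next_factor_given H d u)
        (\<lambda>x. E_Y_given H d (u @ [x]))) = E_upto k (\<lambda>u. E_given u ?sq - (E_Y_given H d u)\<^sup>2)"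
  proof (rule expectation_pmf_cong)
    fix u assume u: "u \<in> set_pmf (posterior_upto H d k)"
    have kn: "k \<le> n_factors H"
      using k by simp
    note Q = set_posterior_given[OF kn u]
    have fin: "finite (set_pmf (next_factor_given H d u))"
      by (simp add: next_factor_given_def Q finite_posterior)
    have "E_given u (\<lambda>v. E_Y_given H d (take (Suc k) v)) =
        E_given u (\<lambda>v. E_given (take (Suc k) v) (predictive_moment H d 1))"
    proof (rule expectation_pmf_cong)
      fix v assume "v \<in> set_pmf (posterior_given H d u)"
      then have "v \<in> set_pmf (posterior H d)"
        unfolding Q by simp
      then show "E_Y_given H d (take (Suc k) v) =
          E_given (take (Suc k) v) (predictive_moment H d 1)"
        using k by (intro given_moments(1)[of "Suc k"] take_in_posterior_upto) auto
    qed
    also have "\<dots> = E_Y_given H d u"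
      using E_given_E_given[OF u, of "Suc k"] given_moments(1)[OF kn u] k by simp
    finally show "measure_pmf.variance (next_factor_given H d u) (\<lambda>x. E_Y_given H d (u @ [x])) =
        E_given u ?sq - (E_Y_given H d u)\<^sup>2"
      using expectation_next_factor[OF k u, of "E_Y_given H d"]
        expectation_next_factor[OF k u, of "\<lambda>w. (E_Y_given H d w)\<^sup>2"]
      unfolding variance_pmf_finite[OF fin] by simp
  qed
  also have "\<dots> = E_upto k (\<lambda>u. E_given u ?sq) - E_upto k (\<lambda>u. (E_Y_given H d u)\<^sup>2)"
    by (intro Bochner_Integration.integral_diff integrable_measure_pmf_finite finite_posterior_upto)
  \<comment> \<open>The function \<open>?sq\<close> depends only on the first k+1 factors, so its
    posterior mean is a mean under the law of that prefix.\<close>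
  also have "E_upto k (\<lambda>u. E_given u ?sq) = E_upto (Suc k) (\<lambda>u. (E_Y_given H d u)\<^sup>2)"
    using k by (subst E_upto_E_given) (simp_all add: posterior_upto_def)
  finally show ?thesis .
qed

lemma posterior_upto_n_factors: "posterior_upto H d (n_factors H) = posterior H d"
  unfolding posterior_upto_def
  using length_posterior by (intro map_pmf_idI) simp

lemma Var_Y_telescope:
  assumes "2 \<le> n_factors H"
  shows "Var_Y H d = E_upto (n_factors H) (Var_Y_given H d)
    + (\<Sum>k = 2..n_factors H. E_upto (k - 1)
        (\<lambda>u. measure_pmf.variance (next_factor_given H d u) (\<lambda>x. E_Y_given H d (u @ [x]))))
    + measure_pmf.variance (posterior_upto H d 1) (E_Y_given H d)"
proof -
  define e where "e k = E_upto k (\<lambda>u. (E_Y_given H d u)\<^sup>2)" for k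
  have "(\<Sum>k = 2..n_factors H. E_upto (k - 1)
        (\<lambda>u. measure_pmf.variance (next_factor_given H d u) (\<lambda>x. E_Y_given H d (u @ [x])))) =
      (\<Sum>k = Suc 1..n_factors H. e k - e (k - 1))"
  proof (rule sum.cong)
    fix k assume "k \<in> {Suc 1..n_factors H}"
    then have k: "k - 1 < n_factors H" "Suc (k - 1) = k"
      by auto
    show "E_upto (k - 1) (\<lambda>u. measure_pmf.variance (next_factor_given H d u)
        (\<lambda>x. E_Y_given H d (u @ [x]))) = e k - e (k - 1)"
      unfolding e_def by (rule E_upto_Var_next_factor[OF k(1), unfolded k(2)])
  qed simp
  also have "\<dots> = e (n_factors H) - e 1"
    using assms by (intro sum_telescope'') simp
  \<comment> \<open>The e_K of the within-variance and the e_1 of the last variance cancel the two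
    ends of the telescoped sum.\<close>
  finally show ?thesis
    using assms by (simp add: Var_Y_eq E_upto_Var_Y_given Var_upto_E_Y_given e_def)
qed

end

theorem proposition3p1:
  fixes H :: "('v, 'd) hmodel" and d :: 'd
  assumes model: "hierarchical_model H d"
    and finite_variance: "integrable (posterior_predictive H d) (\<lambda>y. y\<^sup>2)"
  shows
    "(n_factors H = 1 \<longrightarrow>
        Var_Y H d =
          measure_pmf.expectation (posterior H d) (Var_Y_given H d)
          + measure_pmf.variance (posterior H d) (E_Y_given H d))
     \<and> (2 \<le> n_factors H \<longrightarrow>
        Var_Y H d =
          measure_pmf.expectation (posterior_upto H d (n_factors H)) (Var_Y_given H d)
          + (\<Sum>k = 2..n_factors H.
               measure_pmf.expectation (posterior_upto H d (k - 1))
                 (\<lambda>u. measure_pmf.variance (next_factor_given H d u)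
                        (\<lambda>x. E_Y_given H d (u @ [x]))))
          + measure_pmf.variance (posterior_upto H d 1) (E_Y_given H d))
     \<and> Var_Y H d =
          measure_pmf.expectation (posterior_upto H d (n_factors H)) (Var_Y_given H d)
          + measure_pmf.variance (posterior_upto H d (n_factors H)) (E_Y_given H d)"
proof -
  interpret posterior_model H d
    by unfold_locales (fact model, fact finite_variance)
  \<comment> \<open>All prefixes of full length are the vectors themselves, so the case K = 1 and
    clause (ii) become the same equation.\<close>
  show ?thesis
    using Var_Y_decomposition[OF order.refl] Var_Y_telescope
    unfolding posterior_upto_n_factors by blast
qed

end
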